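(* Let $N\in\mathbb{N}$, let $P^G_y, P^G_\lambda, Q^G_y, Q^G_\lambda\in\mathbb{C}^{N\times N}$ be the coarse propagator derivatives on the subinterval $[T_{\ell-1},T_\ell]$ (as defined in the context), let $d_\ell(\alpha)\in\mathbb{C}$ be one of the diagonal elements described in the context, and let $\delta p,\delta q\in\mathbb{C}^N$. Consider the following procedure. 1. Set $\theta=\arg d_\ell(\alpha)$, so that $e^{\mathrm{i}\theta}=d_\ell(\alpha)$; set $c=e^{\mathrm{i}\theta/2}$, $a=\delta p/c$ and $b=c\,\delta q$. 2. Using the coarse BVP solver, solve the linear system $$z'(t)=g'(y(t))z(t)-\frac{\mu(t)}{\gamma},\qquad \mu'(t)=-H(y(t),\lambda(t))^*z(t)-g'(y(t))^*\mu(t)$$ on $[T_{\ell-1},T_\ell]$ with boundary conditions $$-d_\ell(\alpha)^*\,z(T_{\ell-1})+z(T_\ell)=a,\qquad \mu(T_{\ell-1})-d_\ell(\alpha)\,\mu(T_\ell)=b.$$ 3. Set $\delta y=-z(T_{\ell-1})/c$ and $\delta\lambda=-c\,\mu(T_\ell)$. Then the output pair $(\delta y,\delta\lambda)$ satisfies $$\begin{bmatrix} I-d_\ell(\alpha)P^G_y & -P^G_\lambda\\ -Q^G_y & I-d_\ell(\alpha)^*Q^G_\lambda\end{bmatrix}\begin{bmatrix}\delta y\\ \delta\lambda\end{bmatrix}=\begin{bmatrix}\delta p\\ \delta q\end{bmatrix}.$$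
   Context: Here $g:\mathbb{R}^N\to\mathbb{R}^N$ is the (sufficiently smooth) right-hand side function, $\gamma>0$ is a regularization parameter, $g'$ is the Jacobian of $g$, and $H(y,\lambda)^*$ is the Jacobian with respect to $y$ of $g'(y)^*\lambda$. The superscript $*$ on matrices denotes the conjugate transpose and on scalars the complex conjugate. The functions $(y(t),\lambda(t))$ on $[T_{\ell-1},T_\ell]$ are given: they solve $y'=g(y)-\lambda/\gamma$, $\lambda'=-g'(y)^*\lambda$ on this subinterval with prescribed values of $y(T_{\ell-1})$ and $\lambda(T_\ell)$. They are fixed coefficients of the linear system ("derivative system") for $(z,\mu)$ in the claim, where $z,\mu$ are $\mathbb{C}^N$-valued. Coarse BVP solver and propagator derivatives. A coarse BVP solver is a fixed numerical solver (discretization) of the linear derivative system, to be used with any prescribed boundary conditions; call "coarse solutions" the pairs $(z,\mu)$ satisfying the discretized derivative system. The matrices $P^G_y,P^G_\lambda,Q^G_y,Q^G_\lambda$ are the derivatives of the coarse propagators, as represented by this solver: the coarse solution with boundary values $z(T_{\ell-1})=\delta y$ and $\mu(T_\ell)=\delta\lambda$ is unique and has $$z(T_\ell)=P^G_y\,\delta y+P^G_\lambda\,\delta\lambda,\qquad \mu(T_{\ell-1})=Q^G_y\,\delta y+Q^G_\lambda\,\delta\lambda$$ for all $\delta y,\delta\lambda\in\mathbb{C}^N$. Step 2 of the procedure returns a coarse solution $(z,\mu)$ that satisfies the boundary conditions stated there. The numbers $d_\ell(\alpha)$. Let $L\in\mathbb{N}$, $L\ge 2$, be the number of subintervals and let $\alpha\in\mathbb{C}$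 with $|\alpha|=1$. Let $C(\alpha)\in\mathbb{C}^{L\times L}$ be the matrix with ones on its first subdiagonal, the entry $\alpha$ in the top-right corner, and zeros elsewhere. It is diagonalized as $C(\alpha)=\Gamma_\alpha^{-1}\mathbb{F}^*D(\alpha)\mathbb{F}\Gamma_\alpha$ with $\Gamma_\alpha=\mathrm{diag}(1,\alpha^{1/L},\ldots,\alpha^{(L-1)/L})$ (where $\alpha^{1/L}$ is a fixed $L$-th root of $\alpha$ and $\alpha^{j/L}=(\alpha^{1/L})^j$) and $\mathbb{F}=\{e^{2\pi\mathrm{i}jk/L}/\sqrt{L}\}_{j,k=0}^{L-1}$. The numbers $d_\ell(\alpha)$, $\ell=1,\ldots,L$, are the diagonal elements of the diagonal matrix $D(\alpha)$. *)

theory Defs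
  imports "HOL-Analysis.Analysis" "Jordan_Normal_Form.Schur_Decomposition"
begin

text \<open>Matrices over \<open>complex^'n\<close> come from HOL-Analysis; the \<open>L \<times> L\<close> matrices, whose size is a number,
  are those of \<^theory>\<open>Jordan_Normal_Form.Matrix\<close>, with indices starting at 0.\<close>

definition complexify :: "real^'n^'m \<Rightarrow> complex^'n^'m"
  where "complexify A = map_matrix complex_of_real A"

definition conj_transpose :: "complex^'n^'m \<Rightarrow> complex^'m^'n"
  where "conj_transpose A = map_matrix cnj (Finite_Cartesian_Product.transpose A)"

definition mat_scale :: "complex \<Rightarrow> complex^'n^'m \<Rightarrow> complex^'n^'m"
  where "mat_scale c A = map_matrix (\<lambda>x. c * x) A"

definition block_matrix ::
  "complex^'n^'n \<Rightarrow> complex^'n^'n \<Rightarrow> complex^'n^'n \<Rightarrow> complex^'n^'n \<Rightarrow> complex^('n + 'n)^('n + 'n)"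
  where "block_matrix A B C D =
    (\<chi> i j. case (i, j) of
        (Inl i', Inl j') \<Rightarrow> A $ i' $ j'
      | (Inl i', Inr j') \<Rightarrow> B $ i' $ j'
      | (Inr i', Inl j') \<Rightarrow> C $ i' $ j'
      | (Inr i', Inr j') \<Rightarrow> D $ i' $ j')"

definition block_vector :: "complex^'n \<Rightarrow> complex^'n \<Rightarrow> complex^('n + 'n)"
  where "block_vector u v = (\<chi> i. case i of Inl i' \<Rightarrow> u $ i' | Inr i' \<Rightarrow> v $ i')"

definition g_prime :: "(real^'n \<Rightarrow> real^'n) \<Rightarrow> real^'n \<Rightarrow> real^'n^'n"
  where "g_prime g y = jacobian g (at y)"

text \<open>\<open>g'(v)\<close> and \<open>l\<close> are real, so that \<open>g'(v)\<^sup>* l\<close> is written with the real transpose.\<close>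

definition H_mat :: "(real^'n \<Rightarrow> real^'n) \<Rightarrow> real^'n \<Rightarrow> real^'n \<Rightarrow> real^'n^'n"
  where "H_mat g y l = jacobian (\<lambda>v. Finite_Cartesian_Product.transpose (g_prime g v) *v l) (at y)"

definition H_star :: "(real^'n \<Rightarrow> real^'n) \<Rightarrow> real^'n \<Rightarrow> real^'n \<Rightarrow> complex^'n^'n"
  where "H_star g y l = conj_transpose (complexify (H_mat g y l))"

text \<open>\<open>g\<close> is of class \<open>C\<^sup>2\<close>: the components of \<open>g'(v)\<^sup>* l\<close>, for all \<open>l\<close>, run through the
  linear combinations of the first order partial derivatives of \<open>g\<close>.\<close>

definition smooth_rhs :: "(real^'n \<Rightarrow> real^'n) \<Rightarrow> bool"
  where "smooth_rhs g \<longleftrightarrow>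
    (\<forall>v. g differentiable (at v)) \<and>
    (\<forall>l v. (\<lambda>u. Finite_Cartesian_Product.transpose (g_prime g u) *v l) differentiable (at v)) \<and>
    (\<forall>l. continuous_on UNIV (\<lambda>v. H_mat g v l))"

definition solves_nonlinear_bvp ::
  "(real^'n \<Rightarrow> real^'n) \<Rightarrow> real \<Rightarrow> real \<Rightarrow> real \<Rightarrow> real^'n \<Rightarrow> real^'n \<Rightarrow>
   (real \<Rightarrow> real^'n) \<Rightarrow> (real \<Rightarrow> real^'n) \<Rightarrow> bool"
  where "solves_nonlinear_bvp g \<gamma> t0 t1 Y \<Lambda> y l \<longleftrightarrow>
    (\<forall>t\<in>{t0..t1}.
      (y has_vector_derivative (g (y t) - l t /\<^sub>R \<gamma>)) (at t within {t0..t1}) \<and>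
      (l has_vector_derivative (- (Finite_Cartesian_Product.transpose (g_prime g (y t)) *v l t)))
        (at t within {t0..t1})) \<and>
    y t0 = Y \<and> l t1 = \<Lambda>"

text \<open>An ordinary differential equation \<open>(z', \<mu>') = f(t, z, \<mu>)\<close> is represented by its right-hand
  side \<open>f\<close>.\<close>

type_synonym 'n ode = "real \<Rightarrow> (complex^'n) \<times> (complex^'n) \<Rightarrow> (complex^'n) \<times> (complex^'n)"

definition derivative_system ::
  "(real^'n \<Rightarrow> real^'n) \<Rightarrow> real \<Rightarrow> (real \<Rightarrow> real^'n) \<Rightarrow> (real \<Rightarrow> real^'n) \<Rightarrow> 'n ode"
  where "derivative_system g \<gamma> y l = (\<lambda>t (z, \<mu>).
    (complexify (g_prime g (y t)) *v z - \<mu> /\<^sub>R \<gamma>,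
     - (H_star g (y t) (l t) *v z) - conj_transpose (complexify (g_prime g (y t))) *v \<mu>))"

text \<open>A solver on a fixed interval is given by the set of times at which its solutions have values
  (a mesh, or the whole interval for, say, a collocation method) and by the discretized equations that
  it forms from a system of differential equations.  Boundary conditions are not part of the
  discretized equations.  The method and its accuracy are left open.\<close>

record 'n bvp_solver =
  mesh :: "real set"
  discretized :: "'n ode \<Rightarrow> (real \<Rightarrow> complex^'n) \<Rightarrow> (real \<Rightarrow> complex^'n) \<Rightarrow> bool"

definition solver_on :: "('n::finite) bvp_solver \<Rightarrow> real \<Rightarrow> real \<Rightarrow> bool"
  where "solver_on S t0 t1 \<longleftrightarrow> {t0, t1} \<subseteq> mesh S \<and> mesh S \<subseteq> {t0..t1}"

text \<open>Coarse solutions are functions on the mesh, so that they are equal iff they agree on the mesh.\<close>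

definition coarse_solutions ::
  "('n::finite) bvp_solver \<Rightarrow> 'n ode \<Rightarrow> ((real \<Rightarrow> complex^'n) \<times> (real \<Rightarrow> complex^'n)) set"
  where "coarse_solutions S f =
    {(z, \<mu>). z \<in> extensional (mesh S) \<and> \<mu> \<in> extensional (mesh S) \<and> discretized S f z \<mu>}"

definition coarse_propagator_derivatives ::
  "('n::finite) bvp_solver \<Rightarrow> 'n ode \<Rightarrow> real \<Rightarrow> real \<Rightarrow>
   complex^'n^'n \<Rightarrow> complex^'n^'n \<Rightarrow> complex^'n^'n \<Rightarrow> complex^'n^'n \<Rightarrow> bool"
  where "coarse_propagator_derivatives S f t0 t1 Py Pl Qy Ql \<longleftrightarrow>
    (\<forall>\<delta>y \<delta>l.
      (\<exists>!w. w \<in> coarse_solutions S f \<and> fst w t0 = \<delta>y \<and> snd w t1 = \<delta>l) \<and>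
      (\<forall>(z, \<mu>) \<in> coarse_solutions S f. z t0 = \<delta>y \<and> \<mu> t1 = \<delta>l \<longrightarrow>
         z t1 = Py *v \<delta>y + Pl *v \<delta>l \<and> \<mu> t0 = Qy *v \<delta>y + Ql *v \<delta>l))"

definition alpha_circulant :: "nat \<Rightarrow> complex \<Rightarrow> complex mat"
  where "alpha_circulant L \<alpha> = Matrix.mat L L
    (\<lambda>(i, j). if i = j + 1 then 1 else if i = 0 \<and> j = L - 1 then \<alpha> else 0)"

definition fourier_mat :: "nat \<Rightarrow> complex mat"
  where "fourier_mat L = Matrix.mat L L
    (\<lambda>(j, k). exp (2 * complex_of_real pi * \<i> * of_nat j * of_nat k / of_nat L)
              / complex_of_real (sqrt (real L)))"

text \<open>\<open>D\<close> diagonalizes \<open>C(\<alpha>)\<close> as \<open>\<Gamma>\<^sup>-\<^sup>1 F\<^sup>* D F \<Gamma>\<close>, where \<open>\<Gamma>\<close> is formed with the \<open>L\<close>-th root \<open>r\<close> of \<open>\<alpha>\<close>.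
  These equations determine \<open>D\<close>.\<close>

definition circulant_diagonalization :: "nat \<Rightarrow> complex \<Rightarrow> complex \<Rightarrow> complex mat \<Rightarrow> bool"
  where "circulant_diagonalization L \<alpha> r D \<longleftrightarrow>
    D \<in> carrier_mat L L \<and> diagonal_mat D \<and> r ^ L = \<alpha> \<and>
    (let \<Gamma> = mat_diag L (\<lambda>j. r ^ j); F = fourier_mat L in
      \<exists>\<Gamma>inv \<in> carrier_mat L L. inverts_mat \<Gamma> \<Gamma>inv \<and> inverts_mat \<Gamma>inv \<Gamma> \<and>
        alpha_circulant L \<alpha> = \<Gamma>inv * mat_adjoint F * D * F * \<Gamma>)"

end

theory Submission
  imports Defs
begin

text \<open>Why the procedure works.  The propagator identities turn the two block rows applied to
  \<open>(\<delta>y, \<delta>\<lambda>)\<close> into \<open>c z(T\<^sub>k) - c\<^sup>-\<^sup>1 z(T\<^sub>k\<^sub>-\<^sub>1)\<close> and \<open>c\<^sup>-\<^sup>1 \<mu>(T\<^sub>k\<^sub>-\<^sub>1) - c \<mu>(T\<^sub>k)\<close>, provided that \<open>d = c\<^sup>2\<close> and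
  \<open>d\<^sup>* = c\<^sup>-\<^sup>2\<close>; these are \<open>c\<close> and \<open>c\<^sup>-\<^sup>1\<close> times the left-hand sides of the two boundary conditions,
  hence \<open>c a = \<delta>p\<close> and \<open>c\<^sup>-\<^sup>1 b = \<delta>q\<close>.  Splitting the phase of \<open>d\<close> evenly between the two ends of the
  subinterval is what makes both rows come out at once (\<open>derivative_block_system\<close>).

  What remains is \<open>\<bar>d\<bar> = 1\<close>, which gives \<open>e\<^sup>i\<^sup>\<theta> = d\<close> and both relations between \<open>c\<close> and \<open>d\<close>.  Since the
  Fourier matrix is unitary, the diagonalization can be rewritten as \<open>F \<Gamma> C(\<alpha>) = D F \<Gamma>\<close>, and
  comparing first columns yields the eigenvalues in closed form: \<open>r\<close> times an \<open>L\<close>-th root of unity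
  (\<open>circulant_eigenvalue\<close>).  As \<open>r\<^sup>L = \<alpha>\<close> lies on the unit circle, so do they.\<close>

section \<open>The eigenvalues of the circulant matrix\<close>

lemma sum_root_of_unity_quotient:
  fixes L j k :: nat
  assumes "j < L" "k < L"
  defines "x \<equiv> exp (2 * of_real pi * \<i> * of_nat j / of_nat L)
              / exp (2 * of_real pi * \<i> * of_nat k / of_nat L)"
  shows "(\<Sum>m<L. x ^ m) = (if j = k then of_nat L else 0)"
proof (cases "j = k")
  case True
  then show ?thesis by (simp add: x_def)
next
  case False
  have "1 \<le> L" and "L \<noteq> 0" using assms(1) by auto
  have "x \<noteq> 1"
    using False assms(1,2) complex_root_unity_eq[OF \<open>1 \<le> L\<close>, of j k]
    by (simp add: x_def)
  moreover have "x ^ L = 1"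
    using complex_root_unity[OF \<open>L \<noteq> 0\<close>, of j] complex_root_unity[OF \<open>L \<noteq> 0\<close>, of k]
    by (simp add: x_def power_divide)
  ultimately show ?thesis using False by (simp add: geometric_sum)
qed

lemma fourier_mat_unitary: "fourier_mat L * mat_adjoint (fourier_mat L) = 1\<^sub>m L"
proof (rule eq_matI)
  fix j k
  assume "j < dim_row (1\<^sub>m L :: complex mat)" "k < dim_col (1\<^sub>m L :: complex mat)"
  then have jk: "j < L" "k < L" by auto
  define \<omega> :: "nat \<Rightarrow> complex" where "\<omega> n = exp (2 * of_real pi * \<i> * of_nat n / of_nat L)" for n
  define s where "s = complex_of_real (sqrt (real L))"
  have ss: "s * s = of_nat L"
    by (metis of_nat_0_le_iff of_real_mult of_real_of_nat_eq real_sqrt_mult_self s_def abs_of_nonneg)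
  have F: "fourier_mat L $$ (n, m) = \<omega> n ^ m / s" if "n < L" "m < L" for n m
    using that by (simp add: fourier_mat_def \<omega>_def s_def flip: exp_of_nat_mult) (simp add: mult_ac)
  have cnj_\<omega>: "cnj (\<omega> n) = inverse (\<omega> n)" for n
    by (simp add: \<omega>_def exp_cnj flip: exp_minus)
  have dim: "dim_row (fourier_mat L) = L" "dim_col (fourier_mat L) = L"
    by (simp_all add: fourier_mat_def)
  have "(fourier_mat L * mat_adjoint (fourier_mat L)) $$ (j, k)
      = (\<Sum>m<L. (\<omega> j ^ m / s) * cnj (\<omega> k ^ m / s))"
    using jk dim
    by (simp add: scalar_prod_def mat_adjoint_def mat_of_rows_def F lessThan_atLeast0)
  also have "\<dots> = (\<Sum>m<L. (\<omega> j / \<omega> k) ^ m) / (s * s)"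
    unfolding sum_divide_distrib
    by (intro sum.cong) (simp_all add: s_def cnj_\<omega> power_divide divide_inverse power_mult_distrib
        power_inverse mult_ac)
  also have "\<dots> = (if j = k then 1 else 0)"
    using sum_root_of_unity_quotient[OF jk] jk by (simp add: ss \<omega>_def)
  finally show "(fourier_mat L * mat_adjoint (fourier_mat L)) $$ (j, k) = 1\<^sub>m L $$ (j, k)"
    using jk by simp
qed (simp_all add: fourier_mat_def mat_adjoint_def mat_of_rows_def)

text \<open>The first column of \<open>C(\<alpha>)\<close> is the second unit vector, so that the first columns of
  \<open>F \<Gamma> C(\<alpha>) = D F \<Gamma>\<close> are those of \<open>F\<close> with index 1, scaled by \<open>r\<close>, and with index 0, scaled by the
  diagonal elements of \<open>D\<close>.\<close>

lemma circulant_eigenvalue: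
  assumes "circulant_diagonalization L \<alpha> r D" "L \<ge> 2" "j < L"
  shows "D $$ (j, j) = r * exp (2 * of_real pi * \<i> * of_nat j / of_nat L)"
proof -
  define F where "F = fourier_mat L"
  define G where "G = mat_diag L (\<lambda>j. r ^ j)"
  define C where "C = alpha_circulant L \<alpha>"
  define s where "s = complex_of_real (sqrt (real L))"
  have s0: "s \<noteq> 0" using assms(2) by (simp add: s_def)
  have F[simp]: "F \<in> carrier_mat L L" and G[simp]: "G \<in> carrier_mat L L"
    and C[simp]: "C \<in> carrier_mat L L" and FA[simp]: "mat_adjoint F \<in> carrier_mat L L"
    by (auto simp: F_def G_def C_def fourier_mat_def alpha_circulant_def mat_adjoint_def
        mat_of_rows_def)
  from assms(1) obtain Gi where D[simp]: "D \<in> carrier_mat L L" and diag: "diagonal_mat D"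
    and Gi[simp]: "Gi \<in> carrier_mat L L" and inv: "inverts_mat G Gi"
    and eq: "C = Gi * mat_adjoint F * D * F * G"
    unfolding circulant_diagonalization_def Let_def F_def G_def C_def by blast
  have GGi: "G * Gi = 1\<^sub>m L" using inv by (simp add: inverts_mat_def G_def mat_diag_def)
  have FFA: "F * mat_adjoint F = 1\<^sub>m L" by (simp add: F_def fourier_mat_unitary)
  have mult[simp]: "A * B \<in> carrier_mat L L"
    if "A \<in> carrier_mat L L" "B \<in> carrier_mat L L" for A B :: "complex mat"
    using that by (rule mult_carrier_mat)
  have "F * (G * C) = F * ((G * Gi) * (mat_adjoint F * (D * (F * G))))"
    unfolding eq by (simp add: assoc_mult_mat[of _ L L _ L _ L])
  also have "\<dots> = (F * mat_adjoint F) * (D * (F * G))"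
    unfolding GGi by (simp add: left_mult_one_mat[of _ L L] assoc_mult_mat[of _ L L _ L _ L])
  also have "\<dots> = D * (F * G)"
    unfolding FFA by (simp add: left_mult_one_mat[of _ L L])
  finally have key: "(F * (G * C)) $$ (j, 0) = (D * (F * G)) $$ (j, 0)" by simp
  have GC: "(G * C) $$ (m, 0) = (if m = 1 then r else 0)" if "m < L" for m
    using that assms(2)
    by (auto simp: G_def C_def mat_diag_mult_left[of _ L L] alpha_circulant_def)
  have FG: "(F * G) $$ (m, 0) = 1 / s" if "m < L" for m
    using that assms(2)
    by (auto simp: G_def mat_diag_mult_right[of _ L L] F_def fourier_mat_def s_def)
  have "(F * (G * C)) $$ (j, 0) = (\<Sum>m<L. F $$ (j, m) * (G * C) $$ (m, 0))"
    using assms(2,3) carrier_matD[OF F] carrier_matD[OF G] carrier_matD[OF C]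
    by (simp add: times_mat_def[of F] scalar_prod_def lessThan_atLeast0)
  also have "\<dots> = (\<Sum>m<L. if m = 1 then F $$ (j, 1) * r else 0)"
    by (intro sum.cong) (auto simp: GC)
  also have "\<dots> = F $$ (j, 1) * r"
    using assms(2) by simp
  also have "\<dots> = r * exp (2 * of_real pi * \<i> * of_nat j / of_nat L) / s"
    using assms(2,3) by (simp add: F_def fourier_mat_def s_def)
  finally have lhs: "(F * (G * C)) $$ (j, 0) = \<dots>" .
  have "(D * (F * G)) $$ (j, 0) = (\<Sum>m<L. D $$ (j, m) * (F * G) $$ (m, 0))"
    using assms(2,3) carrier_matD[OF F] carrier_matD[OF G] carrier_matD[OF D]
    by (simp add: times_mat_def[of D] scalar_prod_def lessThan_atLeast0)
  also have "\<dots> = (\<Sum>m<L. if m = j then D $$ (j, j) / s else 0)"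
    using diag assms(3) carrier_matD[OF D]
    by (intro sum.cong) (auto simp: FG diagonal_mat_def)
  also have "\<dots> = D $$ (j, j) / s"
    using assms(3) by simp
  finally show ?thesis using key lhs s0 by simp
qed

lemma circulant_eigenvalue_norm:
  assumes "circulant_diagonalization L \<alpha> r D" "L \<ge> 2" "j < L" "cmod \<alpha> = 1"
  shows "cmod (D $$ (j, j)) = 1"
proof -
  have "r ^ L = \<alpha>" using assms(1) by (simp add: circulant_diagonalization_def)
  then have "cmod r ^ L = 1" using assms(4) by (metis norm_power)
  then have "cmod r = 1" using assms(2) power_eq_imp_eq_base[of "cmod r" L 1] by simp
  then show ?thesis
    using circulant_eigenvalue[OF assms(1-3)] by (simp add: norm_mult)
qed

section \<open>The block system\<close>

lemma block_matrix_vector_mult: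
  fixes A B C E :: "complex^'n^'n"
  shows "block_matrix A B C E *v block_vector u v = block_vector (A *v u + B *v v) (C *v u + E *v v)"
proof -
  have split: "(\<Sum>x\<in>UNIV. f x) = (\<Sum>x\<in>UNIV. f (Inl x)) + (\<Sum>x\<in>UNIV. f (Inr x))"
    for f :: "'n + 'n \<Rightarrow> complex"
    by (simp add: sum.Plus flip: UNIV_Plus_UNIV)
  show ?thesis
    by (simp add: Finite_Cartesian_Product.vec_eq_iff matrix_vector_mult_def block_matrix_def block_vector_def split
        split: sum.split)
qed

lemma mat_scale_vector_mult: "mat_scale d P *v u = d *s (P *v u)"
  by (simp add: Finite_Cartesian_Product.vec_eq_iff matrix_vector_mult_def mat_scale_def map_matrix_def sum_distrib_left
      mult_ac)

lemma minus_matrix_vector_mult: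
  fixes A :: "complex^'n^'m"
  shows "(- A) *v u = - (A *v u)"
  by (simp add: Finite_Cartesian_Product.vec_eq_iff matrix_vector_mult_def sum_negf)

text \<open>Here \<open>z\<^sub>0, z\<^sub>1, \<mu>\<^sub>0, \<mu>\<^sub>1\<close> are the boundary values.  The assumptions on \<open>c\<close> and \<open>d\<close> say that \<open>d\<close> is
  unimodular with square root \<open>c\<close>; this is the form in which both rows reduce to the boundary
  conditions by cancelling powers of \<open>c\<close>.\<close>

lemma derivative_block_system:
  fixes z0 z1 \<mu>0 \<mu>1 p q :: "complex^'n"
  assumes c: "c \<noteq> 0" "d = c * c" "cnj d = inverse c * inverse c"
    and propagators: "z1 = Py *v z0 + Pl *v \<mu>1" "\<mu>0 = Qy *v z0 + Ql *v \<mu>1"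
    and bc: "- cnj d *s z0 + z1 = inverse c *s p" "\<mu>0 - d *s \<mu>1 = c *s q"
  shows "block_matrix
      (Finite_Cartesian_Product.mat 1 - mat_scale d Py) (- Pl)
      (- Qy) (Finite_Cartesian_Product.mat 1 - mat_scale (cnj d) Ql)
      *v block_vector (- (inverse c *s z0)) (- (c *s \<mu>1)) = block_vector p q"
proof -
  have neg: "A *v (- (e *s u)) = - (e *s (A *v u))" for A :: "complex^'n^'n" and e u
    by (simp add: Finite_Cartesian_Product.vec_eq_iff matrix_vector_mult_def sum_negf sum_distrib_left mult_ac)
  have p: "p = c *s (- cnj d *s z0 + z1)" and q: "q = inverse c *s (\<mu>0 - d *s \<mu>1)"
    unfolding bc using c(1) by simp_all
  have "(Finite_Cartesian_Product.mat 1 - mat_scale d Py) *v (- (inverse c *s z0))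
      + (- Pl) *v (- (c *s \<mu>1)) = p"
    unfolding p propagators c(3) using c(1,2)
    by (simp add: matrix_vector_mult_diff_rdistrib mat_scale_vector_mult minus_matrix_vector_mult
        neg Finite_Cartesian_Product.vec_eq_iff field_simps)
  moreover have "(- Qy) *v (- (inverse c *s z0))
      + (Finite_Cartesian_Product.mat 1 - mat_scale (cnj d) Ql) *v (- (c *s \<mu>1)) = q"
    unfolding q propagators c(3) using c(1,2)
    by (simp add: matrix_vector_mult_diff_rdistrib mat_scale_vector_mult minus_matrix_vector_mult
        neg Finite_Cartesian_Product.vec_eq_iff field_simps)
  ultimately show ?thesis by (simp only: block_matrix_vector_mult)
qed

theorem mainTheorem1:
  fixes g :: "real^'n \<Rightarrow> real^'n" and \<gamma> :: real
    and L k :: nat and T :: "nat \<Rightarrow> real"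
    and Y \<Lambda> :: "real^'n" and y l :: "real \<Rightarrow> real^'n"
    and S :: "'n bvp_solver"
    and PGy PGl QGy QGl :: "complex^'n^'n"
    and \<alpha> r d c :: complex and D :: "complex mat" and \<theta> :: real
    and \<delta>p \<delta>q a b \<delta>y \<delta>l :: "complex^'n"
    and z \<mu> :: "real \<Rightarrow> complex^'n"
  assumes "smooth_rhs g" and "\<gamma> > 0"
    and "L \<ge> 2" and "k \<in> {1..L}" and "strict_mono_on {0..L} T"
    and "solves_nonlinear_bvp g \<gamma> (T (k - 1)) (T k) Y \<Lambda> y l"
    and "solver_on S (T (k - 1)) (T k)"
    and "coarse_propagator_derivatives S (derivative_system g \<gamma> y l) (T (k - 1)) (T k)
           PGy PGl QGy QGl"
    and "cmod \<alpha> = 1" and "circulant_diagonalization L \<alpha> r D" and "d = D $$ (k - 1, k - 1)"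
    \<comment> \<open>step 1; \<open>\<theta>\<close> may be any value of the argument\<close>
    and "is_Arg d \<theta>" and "c = exp (\<i> * complex_of_real \<theta> / 2)"
    and "a = inverse c *s \<delta>p" and "b = c *s \<delta>q"
    \<comment> \<open>step 2\<close>
    and "(z, \<mu>) \<in> coarse_solutions S (derivative_system g \<gamma> y l)"
    and "- cnj d *s z (T (k - 1)) + z (T k) = a"
    and "\<mu> (T (k - 1)) - d *s \<mu> (T k) = b"
    \<comment> \<open>step 3\<close>
    and "\<delta>y = - (inverse c *s z (T (k - 1)))" and "\<delta>l = - (c *s \<mu> (T k))"
  shows "exp (\<i> * complex_of_real \<theta>) = d \<and>
    block_matrix
      (Finite_Cartesian_Product.mat 1 - mat_scale d PGy) (- PGl)
      (- QGy) (Finite_Cartesian_Product.mat 1 - mat_scale (cnj d) QGl)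
      *v block_vector \<delta>y \<delta>l = block_vector \<delta>p \<delta>q"
proof -
  have "cmod d = 1"
    using circulant_eigenvalue_norm[of L \<alpha> r D "k - 1"] assms(3,4,9-11) by auto
  then have d: "exp (\<i> * complex_of_real \<theta>) = d"
    using assms(12) by (simp add: is_Arg_def)
  have cc: "d = c * c" "cnj d = inverse c * inverse c" and c0: "c \<noteq> 0"
    unfolding assms(13) d[symmetric] by (simp_all add: exp_cnj flip: exp_add exp_minus)
  \<comment> \<open>The solution of step 2 is also the one that belongs to its own values \<open>z(T\<^sub>k\<^sub>-\<^sub>1)\<close> and \<open>\<mu>(T\<^sub>k)\<close>, so that
    the propagators describe it although it was found from other boundary conditions.\<close>
  have "\<forall>(z, \<mu>) \<in> coarse_solutions S (derivative_system g \<gamma> y l).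
      z (T k) = PGy *v z (T (k - 1)) + PGl *v \<mu> (T k)
      \<and> \<mu> (T (k - 1)) = QGy *v z (T (k - 1)) + QGl *v \<mu> (T k)"
    using assms(8) unfolding coarse_propagator_derivatives_def by blast
  then have "z (T k) = PGy *v z (T (k - 1)) + PGl *v \<mu> (T k)"
    "\<mu> (T (k - 1)) = QGy *v z (T (k - 1)) + QGl *v \<mu> (T k)"
    using assms(16) by auto
  from derivative_block_system[OF c0 cc this] assms(14,15,17-20) d
  show ?thesis by simp
qed

end
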